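(* Let $D\subset\mathbb R$ contain the origin and consider the scalar system $\dot x = h(x)$, $x\in D$, where $h(0)=0$ and $x\,h(x)<0$ for all $x\neq 0$ (so that the origin is a stable equilibrium). Suppose that there exist an open neighborhood $D_0\subset D$ of the origin and constants $k>0$ and $0<\alpha<1$ such that $$\operatorname{sign}(x)\,h(x)\le -k|x|^{\alpha}\qquad\text{for all }x\in D_0 .$$ Then the origin is a finite-time-stable equilibrium of the system $\dot x=h(x)$.
   Context: $\operatorname{sign}(x)=-1,0,1$ for $x<0$, $x=0$, $x>0$ respectively. Finite-time stability: consider $\dot y=f(y)$ on a domain $D$ containing the origin with $f(0)=0$. For an initial condition $x$, let $\psi^x$ denote the unique right maximal solution of the system starting at $x$ (the definition presupposes that this solution exists and is unique for each nonzero initial condition, up to the time the origin is reached). The origin is a finite-time-stable equilibrium if there exist an open neighborhood $\mathcal N\subset D$ of the origin and a function $T:\mathcal N\setminus\{0\}\to(0,\infty)$ (the settling-time function) such that: (1) (finite-time convergence) for every $x\in\mathcal N\setminus\{0\}$, $\psi^x$ is defined on $[0,T(x))$, $\psi^x(t)\in\mathcal N\setminus\{0\}$ for all $t\in[0,T(x))$, and $\lim_{t\to T(x)}\psi^x(t)=0$; (2) (Lyapunov stability) for every open neighborhood $U_\epsilon$ of $0$ there is an open subset $U_\delta$ of $\mathcal N$ containing $0$ such that for every $x\in U_\delta\setminus\{0\}$, $\psi^x(t)\in U_\epsilon$ for all $t\in[0,T(x))$. *)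

theory Defs
  imports "HOL-Analysis.Analysis"
begin

text \<open>
  A solution of \<open>y' = f y\<close>, \<open>y 0 = x\<close> on \<open>[0,\<tau>)\<close> with values in \<open>D\<close>, where \<open>\<tau>\<close> may be infinite.
  The equation is read in integrated form (which contains \<open>y 0 = x\<close> as the case \<open>t = 0\<close>), since
  \<open>f\<close> is not assumed to be continuous: requiring a derivative at every time would make solutions
  stop wherever \<open>f\<close> jumps. Every classical solution is a solution in this sense, and
  conversely if \<open>f\<close> is continuous along the solution; both facts are proved below.
  Only the values of \<open>y\<close> on \<open>[0,\<tau>)\<close> are meaningful.
\<close>

definition solution :: "'a::euclidean_space set \<Rightarrow> ('a \<Rightarrow> 'a) \<Rightarrow> 'a \<Rightarrow> (real \<Rightarrow> 'a) \<Rightarrow> ereal \<Rightarrow> bool"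
  where "solution D f x y \<tau> \<longleftrightarrow> 0 < \<tau> \<and>
    (\<forall>t\<ge>0. ereal t < \<tau> \<longrightarrow> y t \<in> D \<and> ((\<lambda>s. f (y s)) has_integral (y t - x)) {0..t})"

definition right_maximal_solution ::
    "'a::euclidean_space set \<Rightarrow> ('a \<Rightarrow> 'a) \<Rightarrow> 'a \<Rightarrow> (real \<Rightarrow> 'a) \<Rightarrow> ereal \<Rightarrow> bool"
  where "right_maximal_solution D f x y \<tau> \<longleftrightarrow> solution D f x y \<tau> \<and>
    (\<forall>z \<sigma>. solution D f x z \<sigma> \<longrightarrow> \<tau> \<le> \<sigma> \<longrightarrow> (\<forall>t\<ge>0. ereal t < \<tau> \<longrightarrow> z t = y t) \<longrightarrow> \<sigma> = \<tau>)"

text \<open>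
  From every nonzero initial condition there is a right maximal solution, and any two of them
  (including their lifetimes) agree as long as the origin has not been reached.
\<close>

definition unique_right_maximal_solutions :: "'a::euclidean_space set \<Rightarrow> ('a \<Rightarrow> 'a) \<Rightarrow> bool"
  where "unique_right_maximal_solutions D f \<longleftrightarrow> (\<forall>x\<in>D - {0}.
    (\<exists>y \<tau>. right_maximal_solution D f x y \<tau>) \<and>
    (\<forall>y \<tau> z \<sigma>. right_maximal_solution D f x y \<tau> \<longrightarrow> right_maximal_solution D f x z \<sigma> \<longrightarrow>
       (\<forall>t\<ge>0. ereal t < \<tau> \<longrightarrow> (\<forall>s\<in>{0..t}. y s \<noteq> 0) \<longrightarrow> ereal t < \<sigma> \<and> z t = y t)))"

text \<open>
  Since right maximal solutions exist and are unique up to the origin, quantifying over all of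
  them amounts to speaking about \<open>\<psi>\<^sup>x\<close>; \<open>T x \<le> \<tau>\<close> says that \<open>\<psi>\<^sup>x\<close> is defined on \<open>[0,T x)\<close>.
\<close>

definition finite_time_stable :: "'a::euclidean_space set \<Rightarrow> ('a \<Rightarrow> 'a) \<Rightarrow> bool"
  where "finite_time_stable D f \<longleftrightarrow>
    f 0 = 0 \<and> unique_right_maximal_solutions D f \<and>
    (\<exists>N T. open N \<and> 0 \<in> N \<and> N \<subseteq> D \<and> (\<forall>x\<in>N - {0}. (0::real) < T x) \<and>
      (\<forall>x\<in>N - {0}. \<forall>y \<tau>. right_maximal_solution D f x y \<tau> \<longrightarrow>
          ereal (T x) \<le> \<tau> \<and> (\<forall>t\<in>{0..<T x}. y t \<in> N - {0}) \<and> (y \<longlongrightarrow> 0) (at_left (T x))) \<and>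
      (\<forall>U. open U \<longrightarrow> 0 \<in> U \<longrightarrow>
        (\<exists>V. open V \<and> 0 \<in> V \<and> V \<subseteq> N \<and>
          (\<forall>x\<in>V - {0}. \<forall>y \<tau>. right_maximal_solution D f x y \<tau> \<longrightarrow> (\<forall>t\<in>{0..<T x}. y t \<in> U)))))"

lemma classical_imp_solution:
  assumes "0 < \<tau>" "y 0 = x"
    and "\<And>t. 0 \<le> t \<Longrightarrow> ereal t < \<tau> \<Longrightarrow> y t \<in> D"
    and "\<And>t. 0 \<le> t \<Longrightarrow> ereal t < \<tau> \<Longrightarrow>
      (y has_vector_derivative f (y t)) (at t within {s. 0 \<le> s \<and> ereal s < \<tau>})"
  shows "solution D f x y \<tau>"
  unfolding solution_def
proof (intro conjI allI impI)
  fix t :: real assume t: "0 \<le> t" "ereal t < \<tau>"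
  show "y t \<in> D" using assms(3) t .
  have sub: "ereal s < \<tau>" if "s \<le> t" for s
    using that t(2) by (meson ereal_less_eq(3) le_less_trans)
  have "((\<lambda>s. f (y s)) has_integral (y t - y 0)) {0..t}"
    using t(1)
  proof (rule fundamental_theorem_of_calculus)
    fix s assume "s \<in> {0..t}"
    then show "(y has_vector_derivative f (y s)) (at s within {0..t})"
      using sub by (intro has_vector_derivative_within_subset[OF assms(4)]) auto
  qed
  then show "((\<lambda>s. f (y s)) has_integral (y t - x)) {0..t}" using assms(2) by simp
qed (use assms in simp)

lemma solution_imp_classical:
  assumes sol: "solution D f x y \<tau>"
    and cont: "continuous_on {t. 0 \<le> t \<and> ereal t < \<tau>} (\<lambda>t. f (y t))"
    and t: "0 \<le> t" "ereal t < \<tau>"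
  shows "y 0 = x"
    and "(y has_vector_derivative f (y t)) (at t within {s. 0 \<le> s \<and> ereal s < \<tau>})"
proof -
  have int: "((\<lambda>s. f (y s)) has_integral (y s - x)) {0..s}" if "0 \<le> s" "ereal s < \<tau>" for s
    using sol that by (simp add: solution_def)
  from int[of 0] t show "y 0 = x"
    using sol by (auto simp: solution_def zero_ereal_def has_integral_refl dest: has_integral_unique)
  obtain b where b: "t < b" "ereal b < \<tau>"
    using ereal_dense2[OF t(2)] by auto
  have sub: "ereal s < \<tau>" if "s \<le> b" for s
    using that b(2) by (meson ereal_less_eq(3) le_less_trans)
  have "((\<lambda>u. integral {0..u} (\<lambda>s. f (y s))) has_vector_derivative f (y t)) (at t within {0..b})"
    using sub t(1) b(1) by (intro integral_has_vector_derivative continuous_on_subset[OF cont]) auto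
  then have "((\<lambda>u. x + integral {0..u} (\<lambda>s. f (y s))) has_vector_derivative f (y t))
      (at t within {0..b})"
    by (auto intro: derivative_eq_intros)
  then have "(y has_vector_derivative f (y t)) (at t within {0..b})"
  proof (rule has_vector_derivative_transform[rotated 2])
    show "t \<in> {0..b}" using t b by simp
    show "y u = x + integral {0..u} (\<lambda>s. f (y s))" if "u \<in> {0..b}" for u
      using integral_unique[OF int[of u]] that sub by simp
  qed
  moreover have "at t within {s. 0 \<le> s \<and> ereal s < \<tau>} = at t within {0..b}"
    using sub b by (intro at_within_nhd[of t "{..<b}"]) auto
  ultimately show "(y has_vector_derivative f (y t)) (at t within {s. 0 \<le> s \<and> ereal s < \<tau>})"
    by simp
qed

end

theory Submission
  imports Defs
begin

text \<open>
  As long as a solution from \<open>x\<close> avoids the origin it keeps the sign of \<open>x\<close>, its modulus decreases,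
  and it loses at least \<open>k (t - s) \<bar>y t\<bar>\<^sup>\<alpha>\<close> over \<open>[s, t]\<close>. Halving the modulus from \<open>a\<close> thus takes
  at most the time \<open>(a/2)\<^sup>1\<^sup>-\<^sup>\<alpha> / k\<close>, and summing this geometric series bounds the time
  spent away from the origin. A maximal solution cannot stop at a nonzero limit, because it could be
  concatenated with a solution starting there; hence it tends to the origin in finite time.
\<close>

section \<open>Two facts about real functions: integrals up to an endpoint, and decay times\<close>

text \<open>Monotone convergence applies to the truncations of \<open>f\<close> to intervals
  \<open>{a..c n}\<close> with \<open>c n\<close> increasing to \<open>b\<close>, because
  \<open>f\<close> is nonnegative before \<open>b\<close>. Nothing is known about
  \<open>f b\<close>, but a single point does not affect the integral. This carries the integral
  equation of a solution up to the end of its lifetime.\<close>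

lemma has_integral_at_left_limit:
  fixes f :: "real \<Rightarrow> real"
  assumes "a < b"
    and int: "\<And>t. a \<le> t \<Longrightarrow> t < b \<Longrightarrow> (f has_integral F t) {a..t}"
    and nonneg: "\<And>t. a \<le> t \<Longrightarrow> t < b \<Longrightarrow> 0 \<le> f t"
    and lim: "(F \<longlongrightarrow> l) (at_left b)"
  shows "(f has_integral l) {a..b}"
proof -
  \<comment> \<open>With \<open>Suc n\<close> as denominator the sequence starts at
    \<open>c 0 = a\<close> and stays strictly below \<open>b\<close>.\<close>
  define c where "c n = b - (b - a) / real (Suc n)" for n
  have c: "a \<le> c n" "c n < b" for n
    using \<open>a < b\<close> mult_right_mono[of a b "real n"] by (auto simp: c_def field_simps)
  have c_mono: "c n \<le> c (Suc n)" for n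
    using \<open>a < b\<close> unfolding c_def by (intro diff_left_mono divide_left_mono) auto
  have "(\<lambda>n. b - (b - a) * inverse (real (Suc n))) \<longlonglongrightarrow> b - (b - a) * 0"
    by (intro tendsto_intros LIMSEQ_inverse_real_of_nat)
  then have c_lim: "c \<longlonglongrightarrow> b"
    unfolding c_def by (simp add: divide_inverse)
  have c_left: "filterlim c (at_left b) sequentially"
    using c_lim c(2) by (intro tendsto_imp_filterlim_at_left) auto
  \<comment> \<open>The truncations converge pointwise to \<open>g\<close>: no
    \<open>{a..c n}\<close> contains \<open>b\<close>, so their limit there is 0 whatever
    \<open>f b\<close> is.\<close>
  define g where "g t = (if t < b then f t else 0)" for t
  have "(g has_integral l) {a..b}"
  proof (rule has_integral_monotone_convergence_increasing)
    show "((\<lambda>t. if t \<in> {a..c n} then f t else 0) has_integral F (c n)) {a..b}" for n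
      using int[OF c, of n] c(2)[of n] by (subst has_integral_restrict) auto
    show "(if t \<in> {a..c n} then f t else 0) \<le> (if t \<in> {a..c (Suc n)} then f t else 0)"
      if "t \<in> {a..b}" for n t
      using c_mono[of n] c(2)[of "Suc n"] nonneg[of t] that by auto
    show "(\<lambda>n. F (c n)) \<longlonglongrightarrow> l"
      using filterlim_compose[OF lim c_left] .
    show "(\<lambda>n. if t \<in> {a..c n} then f t else 0) \<longlonglongrightarrow> g t" if t: "t \<in> {a..b}" for t
    proof (cases "t < b")
      case True
      then have "\<forall>\<^sub>F n in sequentially. t < c n"
        using order_tendstoD(1)[OF c_lim] by blast
      then have "\<forall>\<^sub>F n in sequentially. (if t \<in> {a..c n} then f t else 0) = g t"
        by eventually_elim (use t True in \<open>auto simp: g_def\<close>)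
      then show ?thesis by (rule tendsto_eventually)
    next
      case False
      then have "(if t \<in> {a..c n} then f t else 0) = g t" for n
        using c(2)[of n] by (auto simp: g_def)
      then show ?thesis by simp
    qed
  qed
  then show ?thesis
    by (rule has_integral_spike_finite[of "{b}", rotated 2]) (auto simp: g_def)
qed

text \<open>Induction on the number \<open>n\<close> of halvings that lead from \<open>u a\<close>
  down to \<open>u b\<close>, with the left endpoint varying. The bound does not depend on
  \<open>n\<close>, since successive halvings cost the terms of a geometric series with ratio
  \<open>q\<close>, whose sum is \<open>q + q^2 + ... = q / (1 - q)\<close>.\<close>

lemma decay_time_bound:
  fixes u :: "real \<Rightarrow> real"
  assumes "0 \<le> k" "\<alpha> < 1" "0 \<le> \<alpha>" "a \<le> b"
    and cont: "continuous_on {a..b} u"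
    and pos: "\<And>t. a \<le> t \<Longrightarrow> t \<le> b \<Longrightarrow> 0 < u t"
    and decay: "\<And>s t. a \<le> s \<Longrightarrow> s \<le> t \<Longrightarrow> t \<le> b \<Longrightarrow> u t + k * (t - s) * u t powr \<alpha> \<le> u s"
  defines "q \<equiv> (1 / 2) powr (1 - \<alpha>)"
  shows "k * (b - a) \<le> q / (1 - q) * u a powr (1 - \<alpha>)"
proof -
  have q: "0 < q" "q < 1"
    using \<open>\<alpha> < 1\<close> powr_less_mono2[of "1 - \<alpha>" "1/2" 1] by (auto simp: q_def)
  define C where "C = q / (1 - q)"
  \<comment> \<open>The inequality absorbs an incomplete last phase; the equation is the recursion
    for one full halving followed by the rest.\<close>
  have C: "q \<le> C" "q * (1 + C) = C"
    using q by (auto simp: C_def field_simps)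
  \<comment> \<open>As long as \<open>u\<close> is at least half its initial value, the loss is at
    most \<open>u a / 2\<close> while the rate of loss is at least
    \<open>k * (u a / 2) powr \<alpha>\<close>. Cancelling this power leaves the exponent 1 -
    \<alpha>. The local \<open>a\<close> allows use at every stage of the induction.\<close>
  have halve: "k * (c - a) \<le> q * u a powr (1 - \<alpha>)"
    if "a \<le> c" "c \<le> b" "u a / 2 \<le> u c"
      "\<And>s t. a \<le> s \<Longrightarrow> s \<le> t \<Longrightarrow> t \<le> b \<Longrightarrow> u t + k * (t - s) * u t powr \<alpha> \<le> u s"
      "0 < u a" for a c
  proof -
    have "k * (c - a) * (u a / 2) powr \<alpha> \<le> k * (c - a) * u c powr \<alpha>"
      using that assms(1,3) by (intro mult_left_mono powr_mono2) auto
    also have "\<dots> \<le> u a / 2"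
      using that(4)[of a c, OF order_refl that(1,2)] that(3) by linarith
    also have "\<dots> = (u a / 2) powr (1 - \<alpha>) * (u a / 2) powr \<alpha>"
      using that(5) by (simp flip: powr_add)
    finally have "k * (c - a) \<le> (u a / 2) powr (1 - \<alpha>)"
      using that(5) by simp
    also have "\<dots> = q * u a powr (1 - \<alpha>)"
      using that(5) powr_mult[of "1/2" "u a" "1 - \<alpha>"] by (simp add: q_def)
    finally show ?thesis .
  qed
  have ub: "0 < u b" using pos \<open>a \<le> b\<close> by simp
  obtain n where "u a / u b < 2 ^ n"
    using real_arch_pow[of 2 "u a / u b"] by auto
  then have "u a \<le> 2 ^ n * u b"
    using ub by (simp add: field_simps)
  then have "k * (b - a) \<le> C * u a powr (1 - \<alpha>)"
    using \<open>a \<le> b\<close> cont pos decay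
  proof (induction n arbitrary: a)
    case (0 a)
    have "u a / 2 \<le> u b" using 0(1) ub by simp
    then have "k * (b - a) \<le> q * u a powr (1 - \<alpha>)"
      using 0 by (intro halve) auto
    also have "\<dots> \<le> C * u a powr (1 - \<alpha>)"
      using C(1) by (intro mult_right_mono) auto
    finally show ?case .
  next
    case (Suc n a)
    have ua: "0 < u a" using Suc.prems by simp
    show ?case
    proof (cases "u a / 2 \<le> u b")
      case True
      have "k * (b - a) \<le> q * u a powr (1 - \<alpha>)"
        using Suc.prems True ua by (intro halve) auto
      also have "\<dots> \<le> C * u a powr (1 - \<alpha>)"
        using C(1) by (intro mult_right_mono) auto
      finally show ?thesis .
    next
      case False
      \<comment> \<open>At the time \<open>c\<close> of half the initial value one halving is used
        up, so the induction hypothesis covers \<open>{c..b}\<close>.\<close>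
      obtain c where c: "a \<le> c" "c \<le> b" "u c = u a / 2"
        using IVT2'[of u b "u a / 2" a] False ua Suc.prems(2,3) by auto
      have "k * (c - a) \<le> q * u a powr (1 - \<alpha>)"
        using Suc.prems c ua by (intro halve) auto
      moreover have "k * (b - c) \<le> C * u c powr (1 - \<alpha>)"
      proof (rule Suc.IH)
        show "u c \<le> 2 ^ n * u b" using Suc.prems(1) c by simp
        show "continuous_on {c..b} u"
          using Suc.prems(3) by (rule continuous_on_subset) (use c in auto)
      qed (use c Suc.prems in auto)
      moreover have "u c powr (1 - \<alpha>) = q * u a powr (1 - \<alpha>)"
        unfolding c(3) using ua powr_mult[of "1/2" "u a" "1 - \<alpha>"] by (simp add: q_def)
      ultimately have "k * (b - a) \<le> (q * (1 + C)) * u a powr (1 - \<alpha>)"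
        by (simp add: algebra_simps)
      then show ?thesis unfolding C(2) .
    qed
  qed
  then show ?thesis by (simp add: C_def)
qed

section \<open>Solutions in integrated form: increments, continuity, concatenation\<close>

lemma ereal_le_less_trans:
  assumes "s \<le> t" "ereal t < \<tau>"
  shows "ereal s < \<tau>"
  using assms by (meson ereal_less_eq(3) le_less_trans)

lemma solution_at_0:
  assumes "solution D f x y \<tau>"
  shows "y 0 = x"
proof -
  have "((\<lambda>s. f (y s)) has_integral (y 0 - x)) {0..0}"
    using assms by (auto simp: solution_def zero_ereal_def)
  moreover have "((\<lambda>s. f (y s)) has_integral 0) {0..0}"
    by (simp add: has_integral_refl)
  ultimately have "y 0 - x = 0"
    by (rule has_integral_unique)
  then show ?thesis by simp
qed

lemma solution_increment:
  assumes sol: "solution D f x y \<tau>" and "0 \<le> s" "s \<le> t" "ereal t < \<tau>"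
  shows "((\<lambda>r. f (y r)) has_integral (y t - y s)) {s..t}"
proof -
  have s: "((\<lambda>r. f (y r)) has_integral (y s - x)) {0..s}"
    using assms ereal_le_less_trans[OF assms(3,4)] by (auto simp: solution_def)
  have t: "((\<lambda>r. f (y r)) has_integral (y t - x)) {0..t}"
    using assms by (auto simp: solution_def)
  have "(\<lambda>r. f (y r)) integrable_on {s..t}"
    by (rule integrable_subinterval_real[OF has_integral_integrable[OF t]]) (use assms(2) in auto)
  then obtain j where j: "((\<lambda>r. f (y r)) has_integral j) {s..t}"
    by blast
  have "y s - x + j = y t - x"
    using has_integral_combine[OF assms(2,3) s j] t by (rule has_integral_unique)
  then have "j = y t - y s" by (simp add: algebra_simps)
  with j show ?thesis by simp
qed

lemma solution_continuous_on:
  assumes sol: "solution D f x y \<tau>" and "ereal b < \<tau>"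
  shows "continuous_on {0..b} y"
proof (cases "0 \<le> b")
  case True
  have int: "((\<lambda>r. f (y r)) has_integral (y t - x)) {0..t}" if "t \<in> {0..b}" for t
    using assms that ereal_le_less_trans[of t b] by (auto simp: solution_def)
  have "continuous_on {0..b} (\<lambda>t. x + integral {0..t} (\<lambda>r. f (y r)))"
    using int[of b] True by (intro continuous_intros indefinite_integral_continuous_1) auto
  then show ?thesis
    by (rule continuous_on_eq) (simp add: integral_unique[OF int])
qed auto

text \<open>The point \<open>w\<close> stands for the left limit of \<open>y\<close> at
  \<open>b\<close>. The value \<open>y b\<close> is meaningless for a solution on [0,b), so
  \<open>end_int\<close> expresses the limit through the integral, which ignores the integrand at
  \<open>b\<close>.\<close>

lemma solution_concat:
  assumes y: "solution D f x y (ereal b)"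
    and end_int: "((\<lambda>s. f (y s)) has_integral (w - x)) {0..b}"
    and z: "solution D f w z \<sigma>"
  shows "solution D f x (\<lambda>t. if t < b then y t else z (t - b)) (ereal b + \<sigma>)"
proof -
  let ?v = "\<lambda>t. if t < b then y t else z (t - b)"
  have b: "0 < b" using y by (simp add: solution_def)
  have \<sigma>: "0 < \<sigma>" using z by (simp add: solution_def)
  have left: "((\<lambda>s. f (?v s)) has_integral i) {0..t}"
    if "((\<lambda>s. f (y s)) has_integral i) {0..t}" "t \<le> b" for t i
    using that by (intro has_integral_spike_finite[of "{b}", OF _ _ that(1)]) auto
  have "?v t \<in> D \<and> ((\<lambda>s. f (?v s)) has_integral (?v t - x)) {0..t}"
    if t: "0 \<le> t" "ereal t < ereal b + \<sigma>" for t
  proof (cases "t < b")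
    case True
    with y t left[of "y t - x" t] show ?thesis by (auto simp: solution_def)
  next
    case False
    have "ereal (t - b) < \<sigma>"
      using t(2) by (cases \<sigma>) auto
    then have z': "z (t - b) \<in> D" "((\<lambda>s. f (z s)) has_integral (z (t - b) - w)) {0..t - b}"
      using z False by (auto simp: solution_def)
    have "((\<lambda>s. f (z (s - b))) has_integral (z (t - b) - w)) {b..t}"
      using has_integral_shift_real_ivl[OF z'(2), of "-b"] by simp
    then have "((\<lambda>s. f (?v s)) has_integral (z (t - b) - w)) {b..t}"
      by (rule has_integral_eq[rotated]) auto
    from has_integral_combine[OF _ _ left[OF end_int order_refl] this]
    show ?thesis using z'(1) b False by (simp add: algebra_simps)
  qed
  then show ?thesis
    using b \<sigma> by (auto simp: solution_def intro: add_pos_pos)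
qed

section \<open>The modulus of a scalar solution before it reaches the origin\<close>

text \<open>A change of sign would force a zero by the intermediate value theorem. Multiplying by
  \<open>sgn x\<close> treats both signs of \<open>x\<close> at once.\<close>

lemma solution_sgn_eq:
  fixes x :: real
  assumes sol: "solution D h x y \<tau>" and "ereal b < \<tau>"
    and nz: "\<And>s. 0 \<le> s \<Longrightarrow> s \<le> b \<Longrightarrow> y s \<noteq> 0" and t: "0 \<le> t" "t \<le> b"
  shows "sgn (y t) = sgn x"
proof (rule ccontr)
  assume ne: "sgn (y t) \<noteq> sgn x"
  have y0: "y 0 = x" using solution_at_0[OF sol] .
  have "x \<noteq> 0" "y t \<noteq> 0" using nz[of 0] nz[of t] y0 t by auto
  then have "sgn x * y t \<le> 0" "0 \<le> sgn x * y 0"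
    using ne unfolding y0
    by (cases x "0::real" rule: linorder_cases; cases "y t" "0::real" rule: linorder_cases; simp)+
  moreover have "continuous_on {0..t} (\<lambda>s. sgn x * y s)"
    using solution_continuous_on[OF sol ereal_le_less_trans[OF t(2) \<open>ereal b < \<tau>\<close>]]
    by (intro continuous_intros)
  ultimately obtain s where "0 \<le> s" "s \<le> t" "sgn x * y s = 0"
    using IVT2'[of "\<lambda>s. sgn x * y s" t 0 0] t by auto
  then show False using nz[of s] t \<open>x \<noteq> 0\<close> by (simp add: sgn_zero_iff)
qed

text \<open>With constant sign the modulus is \<open>sgn x * y\<close>, so it inherits an integral
  equation by linearity, without differentiating \<open>y\<close>.\<close>

lemma solution_abs_increment:
  fixes x :: real
  assumes sol: "solution D h x y \<tau>" and "ereal b < \<tau>"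
    and nz: "\<And>s. 0 \<le> s \<Longrightarrow> s \<le> b \<Longrightarrow> y s \<noteq> 0" and t: "0 \<le> s" "s \<le> t" "t \<le> b"
  shows "((\<lambda>r. sgn (y r) * h (y r)) has_integral (\<bar>y t\<bar> - \<bar>y s\<bar>)) {s..t}"
proof -
  have sgn: "sgn (y r) = sgn x" if "0 \<le> r" "r \<le> b" for r
    using solution_sgn_eq[OF assms(1,2) nz that] .
  have abs: "\<bar>y r\<bar> = sgn x * y r" if "0 \<le> r" "r \<le> b" for r
    using sgn[OF that] by (metis abs_sgn mult.commute)
  have "ereal t < \<tau>"
    using t(3) \<open>ereal b < \<tau>\<close> by (rule ereal_le_less_trans)
  then have "((\<lambda>r. sgn x * h (y r)) has_integral sgn x * (y t - y s)) {s..t}"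
    using solution_increment[OF sol t(1,2)] by (intro has_integral_mult_right)
  then have "((\<lambda>r. sgn (y r) * h (y r)) has_integral sgn x * (y t - y s)) {s..t}"
    by (rule has_integral_eq[rotated]) (use sgn t in simp)
  moreover have "sgn x * (y t - y s) = \<bar>y t\<bar> - \<bar>y s\<bar>"
    using t by (simp only: right_diff_distrib abs[of s] abs[of t])
  ultimately show ?thesis by (simp only:)
qed

lemma solution_abs_antimono:
  fixes x :: real
  assumes sol: "solution D h x y \<tau>" and b: "ereal b < \<tau>"
    and nz: "\<And>s. 0 \<le> s \<Longrightarrow> s \<le> b \<Longrightarrow> y s \<noteq> 0" and t: "0 \<le> s" "s \<le> t" "t \<le> b"
    and neg: "\<And>z. z \<in> D \<Longrightarrow> z \<noteq> 0 \<Longrightarrow> z * h z < 0"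
  shows "\<bar>y t\<bar> \<le> \<bar>y s\<bar>"
proof -
  have "sgn (y r) * h (y r) \<le> 0" if "r \<in> {s..t}" for r
  proof -
    have "ereal r < \<tau>"
      using that t(3) by (intro ereal_le_less_trans[OF _ b]) auto
    then have "y r \<in> D" using sol that t by (auto simp: solution_def)
    then show ?thesis using neg[of "y r"] by (auto simp: sgn_if mult_less_0_iff)
  qed
  then have "\<bar>y t\<bar> - \<bar>y s\<bar> \<le> 0"
    using has_integral_le[OF solution_abs_increment[OF sol b nz t] has_integral_0] by blast
  then show ?thesis by simp
qed

text \<open>The modulus decreases, so on [s,t] it is at least its final value, and the speed is at
  least \<open>k * \<bar>y t\<bar> powr \<alpha>\<close>. Integrating this constant gives the claim.
  The hypothesis \<open>rate\<close> applies throughout because the modulus never exceeds that of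
  \<open>x\<close>.\<close>

lemma solution_abs_decay:
  fixes x :: real
  assumes sol: "solution D h x y \<tau>" and b: "ereal b < \<tau>"
    and nz: "\<And>s. 0 \<le> s \<Longrightarrow> s \<le> b \<Longrightarrow> y s \<noteq> 0" and t: "0 \<le> s" "s \<le> t" "t \<le> b"
    and neg: "\<And>z. z \<in> D \<Longrightarrow> z \<noteq> 0 \<Longrightarrow> z * h z < 0"
    and rate: "\<And>z. \<bar>z\<bar> \<le> \<bar>x\<bar> \<Longrightarrow> sgn z * h z \<le> - k * \<bar>z\<bar> powr \<alpha>"
    and "0 \<le> k" "0 \<le> \<alpha>"
  shows "\<bar>y t\<bar> + k * (t - s) * \<bar>y t\<bar> powr \<alpha> \<le> \<bar>y s\<bar>"
proof -
  have anti: "\<bar>y q\<bar> \<le> \<bar>y p\<bar>" if "0 \<le> p" "p \<le> q" "q \<le> b" for p q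
    using solution_abs_antimono[OF sol b nz that neg] .
  have "sgn (y r) * h (y r) \<le> - k * \<bar>y t\<bar> powr \<alpha>" if "r \<in> {s..t}" for r
  proof -
    have "sgn (y r) * h (y r) \<le> - k * \<bar>y r\<bar> powr \<alpha>"
      using anti[of 0 r] that t solution_at_0[OF sol] by (intro rate) auto
    also have "\<dots> \<le> - k * \<bar>y t\<bar> powr \<alpha>"
      using anti[of r t] that t \<open>0 \<le> k\<close> \<open>0 \<le> \<alpha>\<close> by (auto intro!: mult_left_mono powr_mono2)
    finally show ?thesis .
  qed
  then have "\<bar>y t\<bar> - \<bar>y s\<bar> \<le> (t - s) * (- k * \<bar>y t\<bar> powr \<alpha>)"
    using has_integral_le[OF solution_abs_increment[OF sol b nz t]
        has_integral_const_real[of "- k * \<bar>y t\<bar> powr \<alpha>" s t]] t by simp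
  then show ?thesis by (simp add: algebra_simps)
qed

section \<open>Convergence of maximal solutions to the origin\<close>

text \<open>If the solution vanishes during its lifetime, \<open>T\<close> is its first zero;
  otherwise the lifetime is finite and \<open>T\<close> is its end.\<close>

lemma right_maximal_solution_reaches_0:
  fixes x :: real
  assumes max: "right_maximal_solution D h x y \<tau>" and "x \<noteq> 0"
    and ex: "\<And>w. w \<in> D \<Longrightarrow> w \<noteq> 0 \<Longrightarrow> \<exists>z \<sigma>. solution D h w z \<sigma>"
    and neg: "\<And>z. z \<in> D \<Longrightarrow> z \<noteq> 0 \<Longrightarrow> z * h z < 0"
    and sub: "{- \<bar>x\<bar>..\<bar>x\<bar>} \<subseteq> D"
    and rate: "\<And>z. \<bar>z\<bar> \<le> \<bar>x\<bar> \<Longrightarrow> sgn z * h z \<le> - k * \<bar>z\<bar> powr \<alpha>"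
    and "0 < k" "0 \<le> \<alpha>" "\<alpha> < 1"
  shows "\<exists>T>0. ereal T \<le> \<tau> \<and> (\<forall>t\<in>{0..<T}. y t \<noteq> 0 \<and> \<bar>y t\<bar> \<le> \<bar>x\<bar>) \<and> (y \<longlongrightarrow> 0) (at_left T)"
proof -
  have sol: "solution D h x y \<tau>"
    using max by (simp add: right_maximal_solution_def)
  have \<tau>: "0 < \<tau>" using sol by (simp add: solution_def)
  have y0: "y 0 = x" using solution_at_0[OF sol] .
  have anti: "\<bar>y t\<bar> \<le> \<bar>y s\<bar>"
    if "ereal b < \<tau>" "\<And>s. 0 \<le> s \<Longrightarrow> s \<le> b \<Longrightarrow> y s \<noteq> 0" "0 \<le> s" "s \<le> t" "t \<le> b" for b s t
    using solution_abs_antimono[OF sol that neg] .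
  show ?thesis
  proof (cases "\<exists>t\<ge>0. ereal t < \<tau> \<and> y t = 0")
    case True
    then obtain t0 where t0: "0 \<le> t0" "ereal t0 < \<tau>" "y t0 = 0" by blast
    \<comment> \<open>This zero set is compact by continuity, so it has a least element.\<close>
    let ?Z = "{t \<in> {0..t0}. y t = 0}"
    have cont: "continuous_on {0..t0} y"
      using solution_continuous_on[OF sol t0(2)] .
    have "closed ?Z"
      using cont by (intro continuous_closed_preimage_constant) auto
    moreover have "bounded ?Z"
      by (rule bounded_subset[of "{0..t0}"]) auto
    ultimately have "compact ?Z" by (simp add: compact_eq_bounded_closed)
    moreover have "?Z \<noteq> {}" using t0 by auto
    ultimately obtain T where T: "T \<in> ?Z" "\<And>t. t \<in> ?Z \<Longrightarrow> T \<le> t"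
      using compact_attains_inf[of ?Z] by blast
    have "0 < T" using T(1) y0 \<open>x \<noteq> 0\<close> by (cases "T = 0") auto
    have T\<tau>: "ereal T < \<tau>"
      using T(1) by (intro ereal_le_less_trans[OF _ t0(2)]) auto
    have nz: "y t \<noteq> 0" if "0 \<le> t" "t < T" for t
      using T(2)[of t] T(1) that by auto
    have "\<bar>y t\<bar> \<le> \<bar>x\<bar>" if "0 \<le> t" "t < T" for t
      using anti[of t 0 t] nz that y0 ereal_le_less_trans[OF _ T\<tau>, of t] by auto
    moreover have "(y \<longlongrightarrow> 0) (at_left T)"
    proof -
      have "(y \<longlongrightarrow> y T) (at T within {0..t0})"
        using cont T(1) unfolding continuous_on_def by blast
      then have "(y \<longlongrightarrow> y T) (at T within {0..T})"
        by (rule tendsto_within_subset) (use T(1) in auto)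
      moreover have "at T within {0..T} = at_left T"
        using \<open>0 < T\<close> by (intro at_within_nhd[of T "{0<..}"]) auto
      ultimately show ?thesis using T(1) by simp
    qed
    ultimately show ?thesis using \<open>0 < T\<close> T\<tau> nz by (intro exI[of _ T]) auto
  next
    case False
    then have nz: "y t \<noteq> 0" if "0 \<le> t" "ereal t < \<tau>" for t
      using that by blast
    note below = ereal_le_less_trans[where \<tau> = \<tau>]
    have anti': "\<bar>y t\<bar> \<le> \<bar>y s\<bar>" if "0 \<le> s" "s \<le> t" "ereal t < \<tau>" for s t
      using anti[of t s t] nz below that by auto
    define q where "q = (1 / 2 :: real) powr (1 - \<alpha>)"
    \<comment> \<open>This is the bound of \<open>decay_time_bound\<close> for the modulus of
      \<open>y\<close>, divided by \<open>k\<close>. It is independent of the time considered and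
      hence bounds the lifetime.\<close>
    define B where "B = q / (1 - q) * \<bar>x\<bar> powr (1 - \<alpha>) / k"
    have bound: "t \<le> B" if t: "0 \<le> t" "ereal t < \<tau>" for t
    proof -
      have "k * (t - 0) \<le> q / (1 - q) * \<bar>y 0\<bar> powr (1 - \<alpha>)"
        unfolding q_def
      proof (rule decay_time_bound[of k \<alpha> 0 t "\<lambda>t. \<bar>y t\<bar>"])
        show "continuous_on {0..t} (\<lambda>t. \<bar>y t\<bar>)"
          using solution_continuous_on[OF sol t(2)] by (intro continuous_intros)
        show "\<bar>y r\<bar> + k * (r - s) * \<bar>y r\<bar> powr \<alpha> \<le> \<bar>y s\<bar>" if "0 \<le> s" "s \<le> r" "r \<le> t" for s r
          using solution_abs_decay[OF sol t(2) _ that neg rate] nz below[OF _ t(2)] \<open>0 < k\<close> \<open>0 \<le> \<alpha>\<close>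
          by auto
      qed (use \<open>0 < k\<close> \<open>0 \<le> \<alpha>\<close> \<open>\<alpha> < 1\<close> t nz below[OF _ t(2)] in auto)
      then show ?thesis
        unfolding B_def pos_le_divide_eq[OF \<open>0 < k\<close>] by (simp add: y0 mult.commute)
    qed
    have "\<tau> \<noteq> \<infinity>"
    proof
      assume "\<tau> = \<infinity>"
      then show False using bound[of "\<bar>B\<bar> + 1"] by simp
    qed
    then obtain T where T: "\<tau> = ereal T" "0 < T"
      using \<tau> by (cases \<tau>) auto
    have tnz: "y t \<noteq> 0" if "0 \<le> t" "t < T" for t
      using nz that T by simp
    \<comment> \<open>By monotonicity this infimum is the left limit of the modulus at
      \<open>T\<close>, where \<open>y\<close> itself carries no information.\<close>
    define L where "L = (INF t\<in>{0..<T}. \<bar>y t\<bar>)"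
    have bdd: "bdd_below ((\<lambda>t. \<bar>y t\<bar>) ` {0..<T})"
      by (intro bdd_belowI2[of _ 0]) auto
    have "0 \<le> L"
      unfolding L_def using T by (intro cINF_greatest) auto
    have L_le: "L \<le> \<bar>y t\<bar>" if "0 \<le> t" "t < T" for t
      unfolding L_def using bdd that by (intro cINF_lower) auto
    have ev: "\<forall>\<^sub>F t in at_left T. s < t \<and> t < T" if "s < T" for s
      using eventually_at_left_real[OF that] by simp
    have lim_abs: "((\<lambda>t. \<bar>y t\<bar>) \<longlongrightarrow> L) (at_left T)"
    proof (rule order_tendstoI)
      fix a assume "a < L"
      show "\<forall>\<^sub>F t in at_left T. a < \<bar>y t\<bar>"
        using ev[OF T(2)]
      proof eventually_elim
        case (elim t)
        then show ?case using \<open>a < L\<close> L_le[of t] by simp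
      qed
    next
      fix a assume "L < a"
      then obtain s where s: "0 \<le> s" "s < T" "\<bar>y s\<bar> < a"
        unfolding L_def using cINF_less_iff[OF _ bdd, of a] T by auto
      show "\<forall>\<^sub>F t in at_left T. \<bar>y t\<bar> < a"
        using ev[OF s(2)]
      proof eventually_elim
        case (elim t)
        then show ?case using anti'[of s t] s T by simp
      qed
    qed
    have "L = 0"
    proof (rule ccontr)
      assume "L \<noteq> 0"
      \<comment> \<open>The sign of \<open>y\<close> is constant and its modulus tends to
        \<open>L\<close>, so this is the left limit of \<open>y\<close> at \<open>T\<close>, the
        only possible starting point of a continuation.\<close>
      let ?w = "sgn x * L"
      have sgn: "sgn (y t) = sgn x" if "0 \<le> t" "t < T" for t
        using solution_sgn_eq[OF sol, of t t] nz below[of _ t] that T by auto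
      have "L \<le> \<bar>x\<bar>" using L_le[of 0] T y0 by simp
      then have "?w \<in> D" "?w \<noteq> 0"
        using sub \<open>0 \<le> L\<close> \<open>L \<noteq> 0\<close> \<open>x \<noteq> 0\<close> by (auto simp: sgn_if)
      then obtain z \<sigma> where z: "solution D h ?w z \<sigma>" using ex by blast
      \<comment> \<open>The sign is reversed because the passage to the endpoint requires a
        nonnegative integrand.\<close>
      have "((\<lambda>s. - (sgn (y s) * h (y s))) has_integral (\<bar>x\<bar> - L)) {0..T}"
      proof (rule has_integral_at_left_limit[OF T(2)])
        show "((\<lambda>t. \<bar>x\<bar> - \<bar>y t\<bar>) \<longlongrightarrow> \<bar>x\<bar> - L) (at_left T)"
          by (intro tendsto_intros lim_abs)
        fix t assume t: "0 \<le> t" "t < T"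
        show "((\<lambda>s. - (sgn (y s) * h (y s))) has_integral \<bar>x\<bar> - \<bar>y t\<bar>) {0..t}"
          using has_integral_neg[OF solution_abs_increment[OF sol, of t 0 t]] t T y0 tnz by auto
        have "y t \<in> D" using sol t T by (auto simp: solution_def)
        then show "0 \<le> - (sgn (y t) * h (y t))"
          using neg[of "y t"] by (auto simp: sgn_if mult_less_0_iff)
      qed
      \<comment> \<open>Before \<open>T\<close> the signs of \<open>x\<close> and \<open>y s\<close>
        agree and their product is 1, so this factor restores the integrand \<open>h (y s)\<close>
        except possibly at \<open>T\<close>.\<close>
      then have "((\<lambda>s. - sgn x * - (sgn (y s) * h (y s))) has_integral - sgn x * (\<bar>x\<bar> - L)) {0..T}"
        by (rule has_integral_mult_right)
      moreover have "- sgn x * (\<bar>x\<bar> - L) = ?w - x"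
        by (simp add: algebra_simps sgn_if)
      ultimately have "((\<lambda>s. h (y s)) has_integral (?w - x)) {0..T}"
        using sgn \<open>x \<noteq> 0\<close>
        by (intro has_integral_spike_finite[of "{T}" "{0..T}" "\<lambda>s. h (y s)"
              "\<lambda>s. - sgn x * - (sgn (y s) * h (y s))"]) (auto simp: sgn_if)
      \<comment> \<open>The concatenation agrees with \<open>y\<close> up to \<open>T\<close> but
        lives longer by \<sigma> > 0, against maximality.\<close>
      then have "solution D h x (\<lambda>t. if t < T then y t else z (t - T)) (ereal T + \<sigma>)"
        using solution_concat[OF _ _ z] sol T(1) by blast
      moreover have "\<forall>t\<ge>0. ereal t < \<tau> \<longrightarrow> (if t < T then y t else z (t - T)) = y t"
        using T(1) by simp
      moreover have "0 < \<sigma>" using z by (simp add: solution_def)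
      moreover from this have "\<tau> \<le> ereal T + \<sigma>"
        using T(1) by (cases \<sigma>) auto
      ultimately have "ereal T + \<sigma> = \<tau>"
        using max unfolding right_maximal_solution_def by blast
      then show False using \<open>0 < \<sigma>\<close> T(1) by (cases \<sigma>) auto
    qed
    then have "(y \<longlongrightarrow> 0) (at_left T)"
      using lim_abs by (simp add: tendsto_rabs_zero_iff)
    moreover have "\<bar>y t\<bar> \<le> \<bar>x\<bar>" if "0 \<le> t" "t < T" for t
      using anti'[of 0 t] that T y0 by simp
    ultimately show ?thesis using T tnz by (intro exI[of _ T]) auto
  qed
qed

section \<open>Settling-time function, invariance and Lyapunov stability\<close>

theorem theorem3:
  fixes h :: "real \<Rightarrow> real" and D D0 :: "real set" and k \<alpha> :: real
  assumes "0 \<in> D"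
    and "h 0 = 0"
    and "\<forall>x\<in>D. x \<noteq> 0 \<longrightarrow> x * h x < 0"
    and "unique_right_maximal_solutions D h"
    and "open D0" and "0 \<in> D0" and "D0 \<subseteq> D"
    and "k > 0" and "0 < \<alpha>" and "\<alpha> < 1"
    and "\<forall>x\<in>D0. sgn x * h x \<le> - k * \<bar>x\<bar> powr \<alpha>"
  shows "finite_time_stable D h"
proof -
  obtain r where r: "0 < r" "ball 0 r \<subseteq> D0"
    using \<open>open D0\<close> \<open>0 \<in> D0\<close> openE by blast
  \<comment> \<open>A ball suits because the modulus never grows: solutions cannot leave it, and it
    contains the whole interval between \<open>-\<bar>x\<bar>\<close> and
    \<open>\<bar>x\<bar>\<close> on which the decay rate is required.\<close>
  define N where "N = ball (0::real) r"
  have N: "z \<in> N \<longleftrightarrow> \<bar>z\<bar> < r" for z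
    by (simp add: N_def)
  have ND: "N \<subseteq> D" using r(2) \<open>D0 \<subseteq> D\<close> by (auto simp: N_def)
  have ex: "\<exists>y \<tau>. right_maximal_solution D h w y \<tau>" if "w \<in> D" "w \<noteq> 0" for w
    using assms(4) that by (auto simp: unique_right_maximal_solutions_def)
  \<comment> \<open>The bound by the modulus of \<open>x\<close> will give both invariance of
    \<open>N\<close> and Lyapunov stability.\<close>
  define settles where "settles x y \<tau> T \<longleftrightarrow> 0 < T \<and> ereal T \<le> \<tau> \<and>
    (\<forall>t\<in>{0..<T}. y t \<noteq> 0 \<and> \<bar>y t\<bar> \<le> \<bar>x\<bar>) \<and> (y \<longlongrightarrow> 0) (at_left T)"
    for x :: real and y :: "real \<Rightarrow> real" and \<tau> T
  have reach: "\<exists>T. settles x y \<tau> T"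
    if "x \<in> N - {0}" "right_maximal_solution D h x y \<tau>" for x y \<tau>
    unfolding settles_def
  proof (rule right_maximal_solution_reaches_0[OF that(2)])
    show "\<exists>z \<sigma>. solution D h w z \<sigma>" if "w \<in> D" "w \<noteq> 0" for w
      using ex[OF that] by (auto simp: right_maximal_solution_def)
    show "{- \<bar>x\<bar>..\<bar>x\<bar>} \<subseteq> D"
      using that(1) ND by (auto simp: N subset_iff)
    show "sgn z * h z \<le> - k * \<bar>z\<bar> powr \<alpha>" if "\<bar>z\<bar> \<le> \<bar>x\<bar>" for z
      using assms(11) r(2) that \<open>x \<in> N - {0}\<close> by (auto simp: N subset_iff)
  qed (use assms that in auto)
  \<comment> \<open>The settling time must depend on \<open>x\<close> alone. The time found for one
    maximal solution serves all others, since uniqueness makes them agree with it until the origin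
    is reached.\<close>
  have "\<exists>T. \<forall>y \<tau>. right_maximal_solution D h x y \<tau> \<longrightarrow> settles x y \<tau> T" if x: "x \<in> N - {0}" for x
  proof -
    have "x \<in> D - {0}" using x ND by auto
    then obtain y \<tau> where y: "right_maximal_solution D h x y \<tau>" using ex by blast
    obtain T where T: "settles x y \<tau> T" using reach[OF x y] by blast
    have "settles x z \<sigma> T" if z: "right_maximal_solution D h x z \<sigma>" for z \<sigma>
    proof -
      have agree: "ereal t < \<sigma> \<and> z t = y t" if t: "0 \<le> t" "t < T" for t
      proof -
        have "ereal t < \<tau>"
          using T t less_le_trans[of "ereal t" "ereal T"] unfolding settles_def by auto
        moreover have "\<forall>s\<in>{0..t}. y s \<noteq> 0" using T t by (auto simp: settles_def)
        ultimately show ?thesis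
          using assms(4) \<open>x \<in> D - {0}\<close> y z t(1) unfolding unique_right_maximal_solutions_def by blast
      qed
      \<comment> \<open>A lifetime \<open>s < T\<close> is impossible: agreement at time
        \<open>s\<close> itself would place \<open>s\<close> strictly before the end of that
        lifetime.\<close>
      have "ereal T \<le> \<sigma>"
      proof (rule ccontr)
        assume "\<not> ereal T \<le> \<sigma>"
        moreover have "0 < \<sigma>" using z by (simp add: right_maximal_solution_def solution_def)
        ultimately obtain s where "\<sigma> = ereal s" "0 < s" "s < T" by (cases \<sigma>) auto
        then show False using agree[of s] by simp
      qed
      moreover have "(z \<longlongrightarrow> 0) (at_left T)"
      proof (rule Lim_transform_eventually)
        show "(y \<longlongrightarrow> 0) (at_left T)" using T by (simp add: settles_def)
        have "\<forall>\<^sub>F t in at_left T. t \<in> {0<..<T}"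
          using T by (intro eventually_at_left_real) (simp add: settles_def)
        then show "\<forall>\<^sub>F t in at_left T. y t = z t"
          by eventually_elim (use agree in auto)
      qed
      ultimately show ?thesis using T agree by (auto simp: settles_def)
    qed
    then show ?thesis by blast
  qed
  then obtain T where T: "\<And>x y \<tau>. x \<in> N - {0} \<Longrightarrow> right_maximal_solution D h x y \<tau> \<Longrightarrow> settles x y \<tau> (T x)"
    by metis
  have "\<exists>V. open V \<and> 0 \<in> V \<and> V \<subseteq> N \<and>
      (\<forall>x\<in>V - {0}. \<forall>y \<tau>. right_maximal_solution D h x y \<tau> \<longrightarrow> (\<forall>t\<in>{0..<T x}. y t \<in> U))"
    if U: "open U" "0 \<in> U" for U
  proof -
    obtain e where e: "0 < e" "ball 0 e \<subseteq> U" using U openE by blast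
    have "y t \<in> U" if "x \<in> ball 0 (min e r) - {0}" "right_maximal_solution D h x y \<tau>"
      "t \<in> {0..<T x}" for x y \<tau> t
    proof -
      have "settles x y \<tau> (T x)" using that by (intro T) (auto simp: N)
      then have "\<bar>y t\<bar> < e" using that(1,3) by (force simp: settles_def)
      then show ?thesis using e(2) by auto
    qed
    then show ?thesis using e(1) r(1)
      by (intro exI[of _ "ball 0 (min e r)"]) (auto simp: N_def)
  qed
  \<comment> \<open>The choice of \<open>T x\<close> is constrained only through maximal solutions
    from \<open>x\<close>, so the existence of one is what yields positivity.\<close>
  moreover have "0 < T x" if x: "x \<in> N - {0}" for x
  proof -
    obtain y \<tau> where "right_maximal_solution D h x y \<tau>" using ex[of x] x ND by auto
    then show ?thesis using T[OF x] by (auto simp: settles_def)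
  qed
  moreover have "ereal (T x) \<le> \<tau> \<and> (\<forall>t\<in>{0..<T x}. y t \<in> N - {0}) \<and> (y \<longlongrightarrow> 0) (at_left (T x))"
    if "x \<in> N - {0}" "right_maximal_solution D h x y \<tau>" for x y \<tau>
    using T[OF that] that(1) by (force simp: settles_def N)
  ultimately show ?thesis
    unfolding finite_time_stable_def using assms(2,4) ND r(1)
    by (intro conjI exI[of _ N] exI[of _ T]) (auto simp: N_def)
qed

end
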